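(* For any $p,q,x,y\in\mathbb{R}^d$, there exist a symplectic matrix $M\in\mathbb{R}^{4d\times4d}$ and corresponding vectors $\lambda=(\lambda^1,\ldots,\lambda^d)^\intercal,\ \xi=(\xi^1,\ldots,\xi^d)^\intercal\in\mathbb{R}^d$ such that $$M(p,x,q,y)^\intercal=(\tilde p,\tilde p,\tilde q,\tilde q)^\intercal,$$ where $\tilde p=\big(\lambda^1p^1+(1-\lambda^1)x^1,\ldots,\lambda^dp^d+(1-\lambda^d)x^d\big)$ and $\tilde q=\big(\xi^1q^1+(1-\xi^1)y^1,\ldots,\xi^dq^d+(1-\xi^d)y^d\big)$.
   Context: A matrix $M\in\mathbb{R}^{4d\times4d}$ is symplectic if $M^\intercal J_{4d}M=J_{4d}$, where $J_{4d}=\begin{pmatrix}O&I_{2d}\\-I_{2d}&O\end{pmatrix}$. Vectors of $\mathbb{R}^{4d}$ are written in block form $(p,x,q,y)$ with $p,x,q,y\in\mathbb{R}^d$, the first $2d$ coordinates $(p,x)$ being the momenta and the last $2d$ coordinates $(q,y)$ the positions; i.e. the symplectic form is $\sum_{i=1}^d(dp^i\wedge dq^i+dx^i\wedge dy^i)$. *)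

theory Defs
  imports "HOL-Analysis.Analysis"
begin

text \<open>
  The index type \<open>'m + 'n\<close> carries the block structure: \<open>Inl\<close> indices form the first block and
  \<open>Inr\<close> indices the second. Thus \<open>real ^ (('d + 'd) + ('d + 'd))\<close> is the space of vectors
  \<open>(p, x, q, y)\<close> with four blocks of size \<open>d = CARD('d)\<close>, momenta \<open>(p, x)\<close> first.
\<close>

definition block_vec :: "'a ^ 'm::finite \<Rightarrow> 'a ^ 'n::finite \<Rightarrow> 'a ^ ('m + 'n)" where
  "block_vec u v = (\<chi> k. case k of Inl i \<Rightarrow> u $ i | Inr j \<Rightarrow> v $ j)"

definition block_mat ::
  "'a ^ 'k::finite ^ 'm::finite \<Rightarrow> 'a ^ 'l::finite ^ 'm \<Rightarrow> 'a ^ 'k ^ 'n::finite \<Rightarrow> 'a ^ 'l ^ 'n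
    \<Rightarrow> 'a ^ ('k + 'l) ^ ('m + 'n)" where
  "block_mat A B C D = (\<chi> r. case r of
      Inl i \<Rightarrow> block_vec (A $ i) (B $ i)
    | Inr j \<Rightarrow> block_vec (C $ j) (D $ j))"

text \<open>\<open>J\<close> of size \<open>2n\<close>, where \<open>n = CARD('n)\<close>; for \<open>'n = 'd + 'd\<close> this is the form on
  \<open>4d\<close>-dimensional space that pairs \<open>p\<close> with \<open>q\<close> and \<open>x\<close> with \<open>y\<close>.\<close>

definition symplectic_J :: "real ^ ('n::finite + 'n) ^ ('n + 'n)" where
  "symplectic_J = block_mat 0 (mat 1) (- mat 1) 0"

definition symplectic :: "real ^ ('n::finite + 'n) ^ ('n + 'n) \<Rightarrow> bool" where
  "symplectic M \<longleftrightarrow> transpose M ** symplectic_J ** M = symplectic_J"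

end

theory Submission
  imports Defs
begin

text \<open>
  The symplectic group acts transitively on nonzero vectors: a transvection
  \<open>u \<mapsto> u + c \<omega>(u, w) w\<close> along \<open>w = t - z\<close> maps \<open>z\<close> to \<open>t\<close> as soon as \<open>\<omega>(z, t) \<noteq> 0\<close>, and otherwise
  two transvections suffice. It remains to choose the weights so that the target vector vanishes
  only if the source does; weights in \<open>{0, 1}\<close> that pick a nonzero entry in each pair do this.
\<close>

definition symplectic_form :: "real ^ ('n::finite + 'n) \<Rightarrow> real ^ ('n + 'n) \<Rightarrow> real" where
  "symplectic_form u v = u \<bullet> (symplectic_J *v v)"

lemma UNIV_sum_eq:
  fixes f :: "'a::finite + 'b::finite \<Rightarrow> 'c::comm_monoid_add"
  shows "(\<Sum>k\<in>UNIV. f k) = (\<Sum>i\<in>UNIV. f (Inl i)) + (\<Sum>j\<in>UNIV. f (Inr j))"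
  by (simp add: UNIV_Plus_UNIV [symmetric] sum.Plus del: UNIV_Plus_UNIV)

lemma symplectic_J_mult_vec:
  fixes v :: "real ^ ('n::finite + 'n)"
  shows "symplectic_J *v v = (\<chi> k. case k of Inl i \<Rightarrow> v $ Inr i | Inr i \<Rightarrow> - v $ Inl i)"
  by (auto simp: vec_eq_iff matrix_vector_mult_def UNIV_sum_eq symplectic_J_def block_mat_def
      block_vec_def mat_def if_distrib [of "\<lambda>a. a * _"] if_distrib [of uminus] cong: if_cong split: sum.split)

lemma symplectic_form_eq:
  "symplectic_form u v = (\<Sum>i\<in>UNIV. u $ Inl i * v $ Inr i - u $ Inr i * v $ Inl i)"
  by (simp add: symplectic_form_def symplectic_J_mult_vec inner_vec_def UNIV_sum_eq
      sum_subtractf sum_negf)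

lemma symplectic_form_self [simp]: "symplectic_form u u = 0"
  by (simp add: symplectic_form_eq mult.commute)

lemma symplectic_form_commute: "symplectic_form u v = - symplectic_form v u"
  by (simp add: symplectic_form_eq sum_negf [symmetric] mult.commute)

lemma symplectic_form_add_left: "symplectic_form (u + u') v = symplectic_form u v + symplectic_form u' v"
  and symplectic_form_scaleR_left: "symplectic_form (c *\<^sub>R u) v = c * symplectic_form u v"
  and symplectic_form_add_right: "symplectic_form u (v + v') = symplectic_form u v + symplectic_form u v'"
  and symplectic_form_scaleR_right: "symplectic_form u (c *\<^sub>R v) = c * symplectic_form u v"
  and symplectic_form_diff_right: "symplectic_form u (v - v') = symplectic_form u v - symplectic_form u v'"
  by (simp_all add: symplectic_form_def inner_add_left inner_add_right inner_diff_right
      matrix_vector_right_distrib matrix_vector_mult_diff_distrib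
      matrix_vector_mult_scaleR)

text \<open>Since \<open>symplectic_J\<close> squares to minus the identity, applying it to one
  argument turns the form back into the Euclidean inner product, up to sign. Nonvanishing of the
  form can then be arranged through non-orthogonality.\<close>

lemma symplectic_form_J_right: "symplectic_form u (symplectic_J *v v) = - (u \<bullet> v)"
  by (simp add: symplectic_form_eq symplectic_J_mult_vec inner_vec_def UNIV_sum_eq
      sum_subtractf sum_negf)

lemma symplectic_form_J_left: "symplectic_form (symplectic_J *v u) v = u \<bullet> v"
  by (subst symplectic_form_commute) (simp add: symplectic_form_J_right inner_commute)

text \<open>The transpose is the adjoint for the inner product, and a matrix is determined by its
  bilinear form. Symplecticity can thus be checked on vectors, without matrix entries.\<close>

lemma symplectic_iff_form:
  "symplectic M \<longleftrightarrow> (\<forall>u v. symplectic_form (M *v u) (M *v v) = symplectic_form u v)"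
proof -
  have "symplectic M \<longleftrightarrow> (\<forall>u v. u \<bullet> ((transpose M ** symplectic_J ** M) *v v) = u \<bullet> (symplectic_J *v v))"
    unfolding symplectic_def matrix_eq by (metis vector_eq_ldot)
  also have "\<dots> \<longleftrightarrow> (\<forall>u v. symplectic_form (M *v u) (M *v v) = symplectic_form u v)"
  proof -
    have "u \<bullet> (transpose M *v w) = (M *v u) \<bullet> w" for u w
      by (metis dot_lmul_matrix inner_commute transpose_matrix_vector)
    then show ?thesis
      by (simp only: symplectic_form_def matrix_vector_mul_assoc [symmetric])
  qed
  finally show ?thesis .
qed

lemma symplectic_mat_1: "symplectic (mat 1)"
  by (simp add: symplectic_iff_form)

lemma symplectic_mult:
  assumes "symplectic M" "symplectic N"
  shows "symplectic (M ** N)"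
  using assms by (simp add: symplectic_iff_form flip: matrix_vector_mul_assoc)

lemma symplectic_transvection:
  fixes c :: real and w :: "real ^ ('n::finite + 'n)"
  obtains M where "symplectic M" "\<And>u. M *v u = u + (c * symplectic_form u w) *\<^sub>R w"
proof
  let ?f = "\<lambda>u. u + (c * symplectic_form u w) *\<^sub>R w"
  have "linear ?f"
    by (rule linearI) (simp_all add: symplectic_form_add_left symplectic_form_scaleR_left
        algebra_simps)
  then show M: "matrix ?f *v u = ?f u" for u
    by (simp add: matrix_works)
  \<comment> \<open>The two terms linear in \<open>c\<close> cancel by antisymmetry, and the
    quadratic term contains the factor \<open>symplectic_form w w = 0\<close>.\<close>
  have "symplectic_form (?f u) (?f v) = symplectic_form u v" for u v
    using symplectic_form_commute [of w v]
    by (simp add: symplectic_form_add_left symplectic_form_add_right symplectic_form_scaleR_left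
        symplectic_form_scaleR_right algebra_simps)
  then show "symplectic (matrix ?f)"
    by (simp add: symplectic_iff_form M)
qed

lemma symplectic_transitive_form:
  assumes "symplectic_form z t \<noteq> 0"
  obtains M where "symplectic M" "M *v z = t"
proof -
  \<comment> \<open>As \<open>symplectic_form z z = 0\<close>, the value of the form at
    \<open>z\<close> and \<open>t - z\<close> is \<open>symplectic_form z t\<close>; its reciprocal
    as \<open>c\<close> makes the coefficient of \<open>t - z\<close> equal to 1.\<close>
  obtain M where "symplectic M"
    and M: "\<And>u. M *v u = u + (1 / symplectic_form z t * symplectic_form u (t - z)) *\<^sub>R (t - z)"
    using symplectic_transvection by blast
  moreover have "M *v z = t"
    using assms by (simp add: M symplectic_form_diff_right)
  ultimately show thesis
    using that by blast
qed

lemma symplectic_transitive: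
  fixes z t :: "real ^ ('n::finite + 'n)"
  assumes "z \<noteq> 0" "t \<noteq> 0"
  obtains M where "symplectic M" "M *v z = t"
proof -
  \<comment> \<open>The intermediate point is \<open>symplectic_J *v a\<close> with \<open>a\<close>
    orthogonal to neither \<open>z\<close> nor \<open>t\<close>. If \<open>z\<close> and
    \<open>t\<close> are orthogonal, \<open>z + t\<close> has inner products
    \<open>z \<bullet> z\<close> and \<open>t \<bullet> t\<close> with them; otherwise
    \<open>z\<close> itself will do. Going through \<open>s\<close> in every case avoids a split on
    \<open>symplectic_form z t\<close>.\<close>
  define s where "s = symplectic_J *v (if z \<bullet> t = 0 then z + t else z)"
  have "symplectic_form z s \<noteq> 0" "symplectic_form s t \<noteq> 0"
    using assms by (auto simp: s_def symplectic_form_J_left symplectic_form_J_right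
        inner_add_left inner_add_right)
  then obtain M N where "symplectic M" "M *v z = s" "symplectic N" "N *v s = t"
    by (meson symplectic_transitive_form)
  then show thesis
    using that [of "N ** M"] by (metis symplectic_mult matrix_vector_mul_assoc)
qed

lemma block_vec_eq_0_iff [simp]: "block_vec u v = 0 \<longleftrightarrow> u = 0 \<and> v = 0"
  by (auto simp: block_vec_def vec_eq_iff split: sum.splits)

lemma ex_weights_eq_0_iff:
  fixes u v :: "real ^ 'd"
  obtains l :: "real ^ 'd"
  where "(\<chi> i. l $ i * u $ i + (1 - l $ i) * v $ i) = 0 \<longleftrightarrow> u = 0 \<and> v = 0"
proof
  \<comment> \<open>Each entry of the combination is \<open>u $ i\<close> if that is nonzero and
    \<open>v $ i\<close> otherwise, so it vanishes only when both do.\<close>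
  let ?l = "\<chi> i. if u $ i = 0 then 0 else 1"
  show "(\<chi> i. ?l $ i * u $ i + (1 - ?l $ i) * v $ i) = 0 \<longleftrightarrow> u = 0 \<and> v = 0"
    by (auto simp: vec_eq_iff)
qed

theorem theorem3p2:
  fixes p q x y :: "real ^ 'd"
  shows "\<exists>(M :: real ^ (('d + 'd) + ('d + 'd)) ^ (('d + 'd) + ('d + 'd)))
            (l :: real ^ 'd) (\<xi> :: real ^ 'd).
      symplectic M \<and>
      (let p' = (\<chi> i. l $ i * p $ i + (1 - l $ i) * x $ i);
           q' = (\<chi> i. \<xi> $ i * q $ i + (1 - \<xi> $ i) * y $ i)
       in M *v block_vec (block_vec p x) (block_vec q y)
            = block_vec (block_vec p' p') (block_vec q' q'))"
proof -
  obtain l :: "real ^ 'd" where l: "(\<chi> i. l $ i * p $ i + (1 - l $ i) * x $ i) = 0 \<longleftrightarrow> p = 0 \<and> x = 0"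
    by (rule ex_weights_eq_0_iff)
  obtain \<xi> :: "real ^ 'd" where \<xi>: "(\<chi> i. \<xi> $ i * q $ i + (1 - \<xi> $ i) * y $ i) = 0 \<longleftrightarrow> q = 0 \<and> y = 0"
    by (rule ex_weights_eq_0_iff)
  define p' where "p' = (\<chi> i. l $ i * p $ i + (1 - l $ i) * x $ i)"
  define q' where "q' = (\<chi> i. \<xi> $ i * q $ i + (1 - \<xi> $ i) * y $ i)"
  let ?z = "block_vec (block_vec p x) (block_vec q y)"
  let ?t = "block_vec (block_vec p' p') (block_vec q' q')"
  \<comment> \<open>Transitivity covers nonzero vectors only; by this equivalence the one remaining
    case is that both vanish, where the identity matrix serves.\<close>
  have zero_iff: "?t = 0 \<longleftrightarrow> ?z = 0"
    using l \<xi> by (simp add: p'_def q'_def)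
  have "\<exists>M. symplectic M \<and> M *v ?z = ?t"
  proof (cases "?z = 0")
    case True
    then show ?thesis
      using zero_iff symplectic_mat_1 by (metis matrix_vector_mul_lid)
  next
    case False
    then show ?thesis
      using zero_iff symplectic_transitive by metis
  qed
  then show ?thesis
    unfolding Let_def p'_def q'_def by blast
qed

end
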